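(* Let $G=(V,E)$ be a connected graph, let $\widehat{G}=(V,E\cup F)$ be an augmentation with $F\cap E=\emptyset$, and let $uw\in E\cup F$. The lower box inequality $0\le x_{uw}$ is facet-defining for the lifted multicut polytope $\Xi_{G\widehat{G}}$ if and only if both of the following hold: (1) there exists no simple path in $\widehat{G}$ of length at least one, other than the path $(\{u,w\},\{uw\})$, whose two end-nodes are $uw$-cut-nodes of $G$ and each of whose edges is a $uw$-separator of $G$; (2) there exists no simple cycle in $\widehat{G}$ each of whose edges is a $uw$-separator of $G$.
   Context: For distinct nodes $u,w$ we write $uw$ for $\{u,w\}$. Given a connected graph $G=(V,E)$ and $\widehat G=(V,E\cup F)$ with $F\cap E=\emptyset$, $X_{G\widehat{G}}$ is the set of all $x\in\{0,1\}^{E\cup F}$ satisfying: (i) for every cycle $C$ of $G$ with edge set $E_C$ and every $e\in E_C$: $x_e\le\sum_{e'\in E_C\setminus\{e\}}x_{e'}$; (ii) for every $uw\in F$ and every $uw$-path $P$ in $G$ with edge set $E_P$: $x_{uw}\le\sum_{e\in E_P}x_e$; (iii) for every $uw\in F$ and every $uw$-cut $\delta$ of $G$ (a set $\delta=\{st\in E:|\{s,t\}\cap U|=1\}$ for some $U\subseteq V$ with $u\in U$, $w\notin U$): $1-x_{uw}\le\sum_{e\in\delta}(1-x_e)$. The lifted multicut polytope is $\Xi_{G\widehat{G}}=\operatorname{conv}X_{G\widehat{G}}\subseteq\mathbb{R}^{E\cup F}$. For distinct $u,w\in V$ and $S\subseteq V$, $S$ is a $uw$-separator of $G$ if every $uw$-path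 in $G$ contains a node of $S$; an edge $st$ is called a $uw$-separator if the set $\{s,t\}$ is. A node $v$ is a $uw$-cut-node of $G$ if $\{v\}$ is a $uw$-separator of $G$ (in particular $u$ and $w$ themselves are $uw$-cut-nodes). *)

theory Defs
  imports "HOL-Analysis.Analysis"
begin

definition simple_graph :: "'v set \<Rightarrow> 'v set set \<Rightarrow> bool" where
  "simple_graph V E \<longleftrightarrow> finite V \<and> (\<forall>e\<in>E. e \<subseteq> V \<and> card e = 2)"

text \<open>Simple paths and simple cycles are given by their duplicate-free sequences of nodes.\<close>

definition path_edges :: "'v list \<Rightarrow> 'v set set" where
  "path_edges p = {{p ! i, p ! Suc i} |i. Suc i < length p}"

definition cycle_edges :: "'v list \<Rightarrow> 'v set set" where
  "cycle_edges c = insert {last c, hd c} (path_edges c)"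

definition is_path :: "'v set \<Rightarrow> 'v set set \<Rightarrow> 'v list \<Rightarrow> bool" where
  "is_path V E p \<longleftrightarrow> p \<noteq> [] \<and> distinct p \<and> set p \<subseteq> V \<and> path_edges p \<subseteq> E"

definition is_path_between :: "'v set \<Rightarrow> 'v set set \<Rightarrow> 'v \<Rightarrow> 'v \<Rightarrow> 'v list \<Rightarrow> bool" where
  "is_path_between V E u w p \<longleftrightarrow> is_path V E p \<and> hd p = u \<and> last p = w"

definition is_cycle :: "'v set \<Rightarrow> 'v set set \<Rightarrow> 'v list \<Rightarrow> bool" where
  "is_cycle V E c \<longleftrightarrow> length c \<ge> 3 \<and> distinct c \<and> set c \<subseteq> V \<and> cycle_edges c \<subseteq> E"

definition connected_graph :: "'v set \<Rightarrow> 'v set set \<Rightarrow> bool" where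
  "connected_graph V E \<longleftrightarrow>
     simple_graph V E \<and> V \<noteq> {} \<and> (\<forall>s\<in>V. \<forall>t\<in>V. \<exists>p. is_path_between V E s t p)"

definition cut_edges :: "'v set set \<Rightarrow> 'v set \<Rightarrow> 'v set set" where
  "cut_edges E U = {e\<in>E. card (e \<inter> U) = 1}"

definition is_cut_between ::
    "'v set \<Rightarrow> 'v set set \<Rightarrow> 'v \<Rightarrow> 'v \<Rightarrow> 'v set set \<Rightarrow> bool" where
  "is_cut_between V E u w D \<longleftrightarrow> (\<exists>U\<subseteq>V. u \<in> U \<and> w \<notin> U \<and> D = cut_edges E U)"

definition is_separator :: "'v set \<Rightarrow> 'v set set \<Rightarrow> 'v \<Rightarrow> 'v \<Rightarrow> 'v set \<Rightarrow> bool" where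
  "is_separator V E u w S \<longleftrightarrow>
     S \<subseteq> V \<and> (\<forall>p. is_path_between V E u w p \<longrightarrow> set p \<inter> S \<noteq> {})"

definition is_cut_node :: "'v set \<Rightarrow> 'v set set \<Rightarrow> 'v \<Rightarrow> 'v \<Rightarrow> 'v \<Rightarrow> bool" where
  "is_cut_node V E u w v \<longleftrightarrow> is_separator V E u w {v}"

text \<open>
  The space of real vectors indexed by \<open>E \<union> F\<close> is identified with the coordinate subspace
  of \<^typ>\<open>real ^ ('v set)\<close> of vectors vanishing outside \<open>E \<union> F\<close>. Convex hulls, faces and
  affine dimension do not depend on the ambient space.
\<close>

definition lifted_multicuts ::
    "'v::finite set \<Rightarrow> 'v set set \<Rightarrow> 'v set set \<Rightarrow> (real ^ ('v set)) set" where
  "lifted_multicuts V E F = {x.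
     (\<forall>e\<in>E \<union> F. x $ e \<in> {0, 1}) \<and>
     (\<forall>e. e \<notin> E \<union> F \<longrightarrow> x $ e = 0) \<and>
     (\<forall>c. is_cycle V E c \<longrightarrow>
        (\<forall>e\<in>cycle_edges c. x $ e \<le> (\<Sum>e'\<in>cycle_edges c - {e}. x $ e'))) \<and>
     (\<forall>u w p. {u, w} \<in> F \<and> is_path_between V E u w p \<longrightarrow>
        x $ {u, w} \<le> (\<Sum>e\<in>path_edges p. x $ e)) \<and>
     (\<forall>u w D. {u, w} \<in> F \<and> is_cut_between V E u w D \<longrightarrow>
        1 - x $ {u, w} \<le> (\<Sum>e\<in>D. 1 - x $ e))}"

definition lifted_multicut_polytope ::
    "'v::finite set \<Rightarrow> 'v set set \<Rightarrow> 'v set set \<Rightarrow> (real ^ ('v set)) set" where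
  "lifted_multicut_polytope V E F = convex hull (lifted_multicuts V E F)"

text \<open>The linear inequality \<open>a \<bullet> x \<le> b\<close> is valid for \<open>P\<close> and the face it induces is a facet.\<close>

definition facet_defining :: "'a::euclidean_space \<Rightarrow> real \<Rightarrow> 'a set \<Rightarrow> bool" where
  "facet_defining a b P \<longleftrightarrow> (\<forall>x\<in>P. a \<bullet> x \<le> b) \<and> {x\<in>P. a \<bullet> x = b} facet_of P"

lemma lower_box_inequality:
  fixes x :: "real ^ 'n"
  shows "(- axis e 1) \<bullet> x \<le> 0 \<longleftrightarrow> 0 \<le> x $ e"
  by (simp add: inner_axis')

end

theory Submission
  imports Defs
begin

text \<open>
  Since the origin is a lifted multicut, \<open>0 \<le> x\<^bsub>uw\<^esub>\<close> defines a facet iff every vector \<open>c\<close>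
  orthogonal to all lifted multicuts with \<open>x\<^bsub>uw\<^esub> = 0\<close> vanishes off the coordinate \<open>uw\<close>.

  Merging adjacent clusters in decompositions that keep \<open>u\<close> and \<open>w\<close> together shows that such a
  \<open>c\<close> vanishes on all edges that are not \<open>uw\<close>-separators, and that its entries on the edges at
  any node that is not a \<open>uw\<close>-cut-node sum to zero. So in the support of \<open>c\<close> without \<open>uw\<close> only
  cut-nodes have degree one, and a longest path in it yields a forbidden path or cycle.

  Conversely, if \<open>x\<^bsub>uw\<^esub> = 0\<close> then the component of \<open>u\<close> and \<open>w\<close> meets every separator, so that
  alternating sums of the \<open>x\<^sub>e\<close> along a path or cycle of separating edges telescope. They vanish
  for a path between cut-nodes, for an even cycle, and for a cycle through a cut-node. An odd
  cycle avoiding the cut-nodes does not exist: there are two \<open>uw\<close>-paths that meet only in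
  cut-nodes, and each edge of the cycle has exactly one node on each of them.
\<close>

section \<open>Connectivity and cut-nodes\<close>

text \<open>Walks whose nodes all lie in \<open>U\<close>. Allowing repeated nodes makes
  transitivity and symmetry easy, and deleting a separator just shrinks \<open>U\<close>. A start
  outside \<open>U\<close> reaches nothing, so \<open>u\<close> and \<open>w\<close> themselves come
  out as cut-nodes.\<close>

inductive reach :: "'v set set \<Rightarrow> 'v set \<Rightarrow> 'v \<Rightarrow> 'v \<Rightarrow> bool" for E U a where
  reach_refl: "a \<in> U \<Longrightarrow> reach E U a a"
| reach_step: "reach E U a b \<Longrightarrow> {b, c} \<in> E \<Longrightarrow> c \<in> U \<Longrightarrow> reach E U a c"

lemma reach_mem: "reach E U a b \<Longrightarrow> a \<in> U \<and> b \<in> U"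
  by (induction rule: reach.induct) auto

lemma reach_mono_edges: "reach E U a b \<Longrightarrow> E \<subseteq> E' \<Longrightarrow> reach E' U a b"
  by (induction rule: reach.induct) (auto intro: reach.intros)

lemma reach_mono: "reach E U a b \<Longrightarrow> U \<subseteq> U' \<Longrightarrow> reach E U' a b"
  by (induction rule: reach.induct) (auto intro: reach.intros)

lemma reach_trans: "reach E U b c \<Longrightarrow> reach E U a b \<Longrightarrow> reach E U a c"
  by (induction rule: reach.induct) (auto intro: reach.intros)

lemma reach_edge: "{a, b} \<in> E \<Longrightarrow> a \<in> U \<Longrightarrow> b \<in> U \<Longrightarrow> reach E U a b"
  by (auto intro: reach.intros)

lemma reach_sym: "reach E U a b \<Longrightarrow> reach E U b a"
proof (induction rule: reach.induct)
  case base: reach_refl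
  then show ?case by (rule reach_refl)
next
  case step: (reach_step b c)
  then have "reach E U c b"
    using reach_mem[of E U a b] by (intro reach_edge) (auto simp: insert_commute)
  with step show ?case by (blast intro: reach_trans)
qed

section \<open>Edge sets of node sequences, and the link between walks and paths\<close>

lemma path_edges_nth: "Suc i < length p \<Longrightarrow> {p ! i, p ! Suc i} \<in> path_edges p"
  by (auto simp: path_edges_def)

lemma path_edges_Nil [simp]: "path_edges [] = {}"
  and path_edges_single [simp]: "path_edges [a] = {}"
  by (auto simp: path_edges_def)

lemma path_edges_Cons [simp]: "path_edges (a # b # p) = insert {a, b} (path_edges (b # p))"
proof (intro set_eqI iffI)
  fix e assume "e \<in> path_edges (a # b # p)"
  then obtain i where i: "e = {(a # b # p) ! i, (a # b # p) ! Suc i}"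
      "Suc i < length (a # b # p)"
    by (auto simp: path_edges_def)
  then show "e \<in> insert {a, b} (path_edges (b # p))"
    using path_edges_nth[of "i - 1" "b # p"] by (cases i) auto
next
  fix e assume "e \<in> insert {a, b} (path_edges (b # p))"
  then show "e \<in> path_edges (a # b # p)"
    using path_edges_nth[of 0 "a # b # p"] path_edges_nth[of "Suc i" "a # b # p" for i]
    by (fastforce simp: path_edges_def[of "b # p"])
qed

lemma path_edges_snoc:
  "p \<noteq> [] \<Longrightarrow> path_edges (p @ [a]) = insert {last p, a} (path_edges p)"
proof (induction p)
  case (Cons b p)
  then show ?case by (cases p) auto
qed simp

lemma path_edges_take: "path_edges (take n p) \<subseteq> path_edges p"
  by (auto simp: path_edges_def)

lemma path_edges_drop: "path_edges (drop n p) \<subseteq> path_edges p"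
proof
  fix e assume "e \<in> path_edges (drop n p)"
  then obtain i where "e = {p ! (n + i), p ! Suc (n + i)}" "Suc (n + i) < length p"
    by (auto simp: path_edges_def)
  then show "e \<in> path_edges p" by (auto simp: path_edges_def)
qed

lemma path_edges_rev: "path_edges (rev p) = path_edges p"
proof (induction p)
  case (Cons a p)
  then show ?case
    using path_edges_snoc[of "rev p" a] by (cases p) (auto simp: last_rev insert_commute)
qed simp

lemma path_edges_conv_image:
  "path_edges p = (\<lambda>i. {p ! i, p ! Suc i}) ` {..<length p - 1}"
  by (auto simp: path_edges_def)

lemma inj_on_path_edges:
  assumes "distinct p"
  shows "inj_on (\<lambda>i. {p ! i, p ! Suc i}) {..<length p - 1}"
  using assms by (auto simp: inj_on_def doubleton_eq_iff nth_eq_iff_index_eq)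

text \<open>Confining the walk to a prefix of \<open>p\<close> records which later nodes it
  avoids.\<close>

lemma reach_path_nth:
  assumes "path_edges p \<subseteq> E" "i \<le> j" "j < length p"
  shows "reach E (set (take (Suc j) p)) (p ! i) (p ! j)"
  using assms(2,3)
proof (induction j rule: dec_induct)
  case base
  then show ?case by (intro reach_refl) (simp add: take_Suc_conv_app_nth)
next
  case (step k)
  have "reach E (set (take (Suc (Suc k)) p)) (p ! i) (p ! k)"
    using step set_take_subset_set_take[of "Suc k" "Suc (Suc k)" p]
    by (intro reach_mono[OF step.IH]) auto
  moreover have "{p ! k, p ! Suc k} \<in> E"
    using assms(1) step path_edges_nth[of k p] by auto
  ultimately show ?case
    using step by (elim reach_step) (auto simp: take_Suc_conv_app_nth)
qed

lemma reach_of_path: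
  assumes "is_path_between U E a b p"
  shows "reach E U a b"
proof -
  from assms have p: "p \<noteq> []" "set p \<subseteq> U" "path_edges p \<subseteq> E" "hd p = a" "last p = b"
    by (auto simp: is_path_between_def is_path_def)
  then have "reach E (set (take (Suc (length p - 1)) p)) (p ! 0) (p ! (length p - 1))"
    by (intro reach_path_nth) auto
  with p show ?thesis
    by (auto simp: hd_conv_nth last_conv_nth intro: reach_mono)
qed

lemma path_of_reach:
  assumes "reach E U a b"
  shows "\<exists>p. is_path_between U E a b p"
  using assms
proof (induction rule: reach.induct)
  case base: reach_refl
  then have "is_path_between U E a a [a]"
    by (simp add: is_path_between_def is_path_def)
  then show ?case ..
next
  case step: (reach_step b c)
  then obtain p where p: "p \<noteq> []" "distinct p" "set p \<subseteq> U" "path_edges p \<subseteq> E" "hd p = a" "last p = b"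
    by (auto simp: is_path_between_def is_path_def)
  show ?case
  proof (cases "c \<in> set p")
    \<comment> \<open>A walk that returns to a node of the path is shortened to the prefix ending
      there.\<close>
    case True
    then obtain i where i: "i < length p" "p ! i = c" by (auto simp: in_set_conv_nth)
    then have "is_path_between U E a c (take (Suc i) p)"
      using p path_edges_take[of "Suc i" p] set_take_subset[of "Suc i" p]
      by (auto simp: is_path_between_def is_path_def last_conv_nth)
    then show ?thesis ..
  next
    case False
    then have "is_path_between U E a c (p @ [c])"
      using p step by (auto simp: is_path_between_def is_path_def path_edges_snoc)
    then show ?thesis ..
  qed
qed

lemma reach_iff_path: "reach E U a b \<longleftrightarrow> (\<exists>p. is_path_between U E a b p)"
  using reach_of_path path_of_reach by metis

lemma is_separator_iff: "is_separator V E u w S \<longleftrightarrow> S \<subseteq> V \<and> \<not> reach E (V - S) u w"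
  by (auto simp: is_separator_def reach_iff_path is_path_between_def is_path_def)

lemma is_cut_node_iff: "is_cut_node V E u w v \<longleftrightarrow> v \<in> V \<and> \<not> reach E (V - {v}) u w"
  by (simp add: is_cut_node_def is_separator_iff)

text \<open>A duplicate-free path visits \<open>b\<close> only at its last position, so the prefix
  up to any other node misses \<open>b\<close>.\<close>

lemma reach_avoiding_end:
  assumes "is_path_between U E a b p" "x \<in> set p" "x \<noteq> b"
  shows "reach E (set p - {b}) a x"
proof -
  from assms have p: "p \<noteq> []" "distinct p" "path_edges p \<subseteq> E" "hd p = a" "last p = b"
    by (auto simp: is_path_between_def is_path_def)
  obtain i where i: "i < length p" "p ! i = x" using assms by (auto simp: in_set_conv_nth)
  with p assms(3) have "i < length p - 1"
    by (cases "i = length p - 1") (auto simp: last_conv_nth)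
  moreover have "b = p ! (length p - 1)" using p by (simp add: last_conv_nth)
  ultimately have "set (take (Suc i) p) \<subseteq> set p - {b}"
    using p set_take_subset[of "Suc i" p]
    by (auto simp: in_set_conv_nth nth_eq_iff_index_eq)
  moreover have "reach E (set (take (Suc i) p)) (p ! 0) (p ! i)"
    using p i by (intro reach_path_nth) auto
  ultimately show ?thesis
    using i p by (auto simp: hd_conv_nth intro: reach_mono)
qed

text \<open>The node \<open>x\<close> is the last visit of the walk to \<open>S\<close>; what
  follows lies outside \<open>S\<close>.\<close>

lemma reach_last_exit:
  assumes "reach E U a b" "a \<in> S"
  shows "\<exists>x\<in>S \<inter> U. reach E (insert x (U - S)) x b"
  using assms
proof (induction rule: reach.induct)
  case base: reach_refl
  then show ?case by (auto intro: reach_refl)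
next
  case step: (reach_step b c)
  then obtain x where x: "x \<in> S \<inter> U" "reach E (insert x (U - S)) x b" by auto
  show ?case
  proof (cases "c \<in> S")
    case True
    with step show ?thesis by (auto intro: reach_refl)
  next
    case False
    with x step have "reach E (insert x (U - S)) x c" by (auto intro: reach_step)
    with x show ?thesis by blast
  qed
qed

text \<open>A Menger-type statement, proved by appending an edge \<open>v v'\<close>. If
  \<open>v\<close> is a cut-node for the new end, both paths are prolonged through \<open>v\<close>.
  Otherwise a walk avoiding \<open>v\<close> leaves the two paths for the last time at some
  \<open>x\<close>; the path containing \<open>x\<close> is rerouted there, and the other one is
  prolonged through \<open>v\<close>.\<close>

lemma two_paths_meeting_in_cut_nodes:
  assumes "reach E V u v"
  shows "\<exists>p q. is_path_between V E u v p \<and> is_path_between V E u v q \<and>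
    (\<forall>z\<in>set p \<inter> set q. is_cut_node V E u v z)"
  using assms
proof (induction rule: reach.induct)
  case base: reach_refl
  then have "is_path_between V E u u [u]" "is_cut_node V E u u u"
    by (auto simp: is_path_between_def is_path_def is_cut_node_iff dest: reach_mem)
  then show ?case by (intro exI[of _ "[u]"]) auto
next
  case step: (reach_step v v')
  then obtain p q where p: "is_path_between V E u v p" and q: "is_path_between V E u v q"
    and pq: "\<And>z. z \<in> set p \<Longrightarrow> z \<in> set q \<Longrightarrow> is_cut_node V E u v z"
    by blast
  note edge = \<open>{v, v'} \<in> E\<close> \<open>v' \<in> V\<close>
  have edge': "{v', v} \<in> E" using edge by (simp add: insert_commute)
  have "v \<in> V" "u \<in> V" using step reach_mem by fast+
  \<comment> \<open>It suffices to find two node sets that connect the ends and share only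
    cut-nodes, since paths chosen inside them inherit the property.\<close>
  have walks: ?case
    if P: "reach E P u v'" "P \<subseteq> V" and Q: "reach E Q u v'" "Q \<subseteq> V"
      and PQ: "\<And>z. z \<in> P \<Longrightarrow> z \<in> Q \<Longrightarrow> is_cut_node V E u v' z" for P Q
  proof -
    obtain p' q' where "is_path_between P E u v' p'" "is_path_between Q E u v' q'"
      using P Q path_of_reach by meson
    then have "is_path_between V E u v' p'" "is_path_between V E u v' q'"
        "set p' \<subseteq> P" "set q' \<subseteq> Q"
      using P(2) Q(2) by (auto simp: is_path_between_def is_path_def)
    with PQ show ?thesis by blast
  qed
  have cut': "is_cut_node V E u v' v'"
    using edge by (auto simp: is_cut_node_iff dest: reach_mem)
  \<comment> \<open>A walk to \<open>v'\<close> avoiding \<open>z\<close> could be continued to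
    \<open>v\<close>, so old cut-nodes other than \<open>v\<close> persist.\<close>
  have cut: "is_cut_node V E u v' z" if "is_cut_node V E u v z" "z \<noteq> v" for z
  proof -
    have "\<not> reach E (V - {z}) u v'"
    proof
      assume "reach E (V - {z}) u v'"
      then have "reach E (V - {z}) u v"
        using edge' that(2) \<open>v \<in> V\<close> by (auto intro: reach_step)
      with that show False by (simp add: is_cut_node_iff)
    qed
    with that show ?thesis by (simp add: is_cut_node_iff)
  qed
  have through: "reach E (insert v' (set r)) u v'" if "is_path_between V E u v r" for r
  proof -
    have "reach E (set r) u v"
      using that by (intro reach_of_path) (auto simp: is_path_between_def is_path_def)
    then have "reach E (insert v' (set r)) u v" by (auto intro: reach_mono)
    with edge show ?thesis by (auto intro: reach_step)
  qed
  have in_V: "set p \<subseteq> V" "set q \<subseteq> V" using p q by (auto simp: is_path_between_def is_path_def)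
  show ?case
  proof (cases "is_cut_node V E u v' v")
    case True
    have "is_cut_node V E u v' z" if "z \<in> insert v' (set p)" "z \<in> insert v' (set q)" for z
      using that cut[OF pq, of z] True cut' by (cases "z = v") auto
    then show ?thesis
      using in_V edge by (intro walks[OF through[OF p] _ through[OF q]]) auto
  next
    case False
    then have R: "reach E (V - {v}) u v'" using \<open>v \<in> V\<close> by (simp add: is_cut_node_iff)
    have "u \<in> set p \<union> set q" using p by (auto simp: is_path_between_def is_path_def)
    from reach_last_exit[OF R this] obtain x where
      x: "x \<in> set p \<union> set q" "x \<noteq> v"
        "reach E (insert x (V - {v} - (set p \<union> set q))) x v'"
      by blast
    have detour: ?thesis
      if p: "is_path_between V E u v p" and q: "is_path_between V E u v q"
      and pq: "\<And>z. z \<in> set p \<Longrightarrow> z \<in> set q \<Longrightarrow> is_cut_node V E u v z"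
      and x: "x \<in> set p" "reach E (insert x (V - {v} - (set p \<union> set q))) x v'" for p q
    proof (rule walks[OF _ _ through[OF q]])
      \<comment> \<open>The first part leads to \<open>x\<close> without using \<open>v\<close>, the
        second from \<open>x\<close> to \<open>v'\<close> away from both old paths. Hence
        \<open>?P\<close> meets the other path only in old common nodes or in
        \<open>v'\<close>.\<close>
      let ?P = "set p - {v} \<union> insert x (V - {v} - (set p \<union> set q))"
      have "reach E ?P u x"
        using reach_avoiding_end[OF p x(1) \<open>x \<noteq> v\<close>] by (auto intro: reach_mono)
      moreover have "reach E ?P x v'" using x(2) by (auto intro: reach_mono)
      ultimately show "reach E ?P u v'" by (blast intro: reach_trans)
      have in_V: "set p \<subseteq> V" "set q \<subseteq> V" using p q by (auto simp: is_path_between_def is_path_def)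
      then show "?P \<subseteq> V" "insert v' (set q) \<subseteq> V" using x(1) edge by auto
      show "is_cut_node V E u v' z" if "z \<in> ?P" "z \<in> insert v' (set q)" for z
      proof (cases "z = v'")
        case False
        with that x(1) \<open>x \<noteq> v\<close> have "z \<in> set p" "z \<in> set q" "z \<noteq> v" by auto
        then show ?thesis using cut pq by blast
      qed (use cut' in simp)
    qed
    show ?thesis
    proof (cases "x \<in> set p")
      case True
      then show ?thesis using detour[OF p q pq] x by blast
    next
      case False
      then show ?thesis using detour[OF q p pq] x by (simp add: Un_commute)
    qed
  qed
qed

section \<open>Lifted multicuts of decompositions\<close>

lemma cycle_edges_rotate: "cycle_edges (rotate m c) = cycle_edges c"
proof (induction m)
  case (Suc m)
  have "cycle_edges (rotate1 d) = cycle_edges d" for d :: "'a list"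
  proof (cases d)
    case (Cons a p)
    then show ?thesis
      using path_edges_snoc[of p a] by (cases p) (auto simp: cycle_edges_def insert_commute)
  qed simp
  with Suc show ?case by simp
qed simp

lemma is_cycle_rotate: "is_cycle V E (rotate m c) \<longleftrightarrow> is_cycle V E c"
  by (simp add: is_cycle_def cycle_edges_rotate)

lemma cycle_edges_conv_image:
  assumes "c \<noteq> []"
  shows "cycle_edges c = (\<lambda>i. {c ! i, c ! (Suc i mod length c)}) ` {..<length c}"
proof -
  have "{..<length c} = insert (length c - 1) {..<length c - 1}" using assms by (cases c) auto
  moreover have "path_edges c = (\<lambda>i. {c ! i, c ! (Suc i mod length c)}) ` {..<length c - 1}"
    unfolding path_edges_conv_image by (intro image_cong) auto
  ultimately show ?thesis
    using assms by (simp add: cycle_edges_def last_conv_nth hd_conv_nth)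
qed

text \<open>Rotating the cycle makes any chosen edge the closing one, which turns a cycle inequality
  into a path inequality.\<close>

lemma cycle_closing_edge:
  assumes "e \<in> cycle_edges c" "is_cycle V E c"
  obtains d where "is_cycle V E d" "cycle_edges d = cycle_edges c" "e = {last d, hd d}"
proof -
  have c: "length c \<ge> 3" using assms(2) by (simp add: is_cycle_def)
  then have "c \<noteq> []" by auto
  with assms(1) obtain i where i: "i < length c" "e = {c ! i, c ! (Suc i mod length c)}"
    by (auto simp: cycle_edges_conv_image)
  let ?d = "rotate (Suc i) c"
  have "hd ?d = c ! (Suc i mod length c)" using \<open>c \<noteq> []\<close> by (rule hd_rotate_conv_nth)
  moreover have "Suc i + (length c - 1) = i + length c" using \<open>c \<noteq> []\<close> by (cases c) auto
  then have "(Suc i + (length c - 1)) mod length c = i" using i by simp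
  then have "last ?d = c ! i"
    using \<open>c \<noteq> []\<close> nth_rotate[of "length c - 1" c "Suc i"]
    by (simp add: last_conv_nth del: rotate_Suc)
  ultimately show ?thesis
    using assms i by (intro that[of ?d]) (simp_all add: is_cycle_rotate cycle_edges_rotate del: rotate_Suc)
qed

lemma closing_edge_notin_path_edges:
  assumes "is_cycle V E c"
  shows "{last c, hd c} \<notin> path_edges c"
proof
  assume "{last c, hd c} \<in> path_edges c"
  then obtain i where i: "Suc i < length c" "{last c, hd c} = {c ! i, c ! Suc i}"
    by (auto simp: path_edges_def)
  have c: "length c \<ge> 3" "distinct c" using assms by (auto simp: is_cycle_def)
  then have "c \<noteq> []" by auto
  with c i show False
    by (auto simp: last_conv_nth hd_conv_nth doubleton_eq_iff nth_eq_iff_index_eq)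
qed

lemma path_ends_related:
  assumes "\<And>a b. {a, b} \<in> path_edges p \<Longrightarrow> r a b" "reflp r" "transp r" "p \<noteq> []"
  shows "r (hd p) (last p)"
  using assms(4,1)
proof (induction p rule: list_nonempty_induct)
  case (single x)
  then show ?case using assms(2) by (simp add: reflp_def)
next
  case (cons x xs)
  then obtain y ys where "xs = y # ys" by (cases xs) auto
  with cons have "r x (hd xs)" "r (hd xs) (last xs)" by auto
  with assms(3) \<open>xs = y # ys\<close> show ?case by (auto dest: transpD)
qed

text \<open>Walks must stay in \<open>A\<close>, so this is connectedness of the induced subgraph.
  The empty set qualifies and serves as a trivial cluster.\<close>

definition conn :: "'v set set \<Rightarrow> 'v set \<Rightarrow> bool" where
  "conn E A \<longleftrightarrow> (\<forall>a\<in>A. \<forall>b\<in>A. reach E A a b)"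

definition clustering :: "'v set \<Rightarrow> 'v set set \<Rightarrow> 'v set set \<Rightarrow> bool" where
  "clustering V E K \<longleftrightarrow> disjoint K \<and> (\<forall>A\<in>K. A \<subseteq> V \<and> conn E A)"

text \<open>The nodes outside \<open>\<Union>K\<close> form singleton components.\<close>

definition multicut :: "'v::finite set set \<Rightarrow> 'v set set \<Rightarrow> real ^ ('v set)" where
  "multicut D K = (\<chi> e. if e \<in> D \<and> \<not> (\<exists>A\<in>K. e \<subseteq> A) then 1 else 0)"

lemma reach_crosses:
  assumes "reach E U a b" "a \<in> S" "b \<notin> S"
  shows "\<exists>s\<in>S \<inter> U. \<exists>t\<in>U - S. {s, t} \<in> E"
  using assms
proof (induction rule: reach.induct)
  case step: (reach_step b c)
  then show ?case using reach_mem[OF step.hyps(1)] by (cases "b \<in> S") auto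
qed simp

text \<open>Along a path whose edges all have value 0 the component never changes, which gives the
  path and cycle inequalities. A cut between two nodes of one cluster contains an edge inside that
  connected cluster, which gives the cut inequalities.\<close>

lemma multicut_mem:
  assumes D: "simple_graph V (E \<union> F)" and K: "clustering V E K"
  shows "multicut (E \<union> F) K \<in> lifted_multicuts V E F"
proof -
  let ?x = "multicut (E \<union> F) K"
  \<comment> \<open>The equality disjunct accounts for the singleton components and makes the
    relation reflexive.\<close>
  define same where "same a b \<longleftrightarrow> a = b \<or> (\<exists>A\<in>K. a \<in> A \<and> b \<in> A)" for a b
  have x01: "?x $ e = 0 \<or> ?x $ e = 1" for e by (simp add: multicut_def)
  have x_nonneg: "0 \<le> ?x $ e" and x_le1: "?x $ e \<le> 1" for e by (simp_all add: multicut_def)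
  have "reflp same" "transp same"
    using K by (auto simp: same_def reflp_def transp_def clustering_def dest: disjointD)
  have pair: "a \<noteq> b" if "{a, b} \<in> E \<union> F" for a b
    using D that by (fastforce simp: simple_graph_def)
  have x0: "?x $ {a, b} = 0 \<longleftrightarrow> same a b" if "{a, b} \<in> E \<union> F" for a b
    using pair[OF that] that by (auto simp: multicut_def same_def)
  \<comment> \<open>Allowing the end pair to lie in \<open>E\<close> or \<open>F\<close> covers both
    the cycle and the path inequalities.\<close>
  have path: "?x $ {hd p, last p} \<le> (\<Sum>e\<in>path_edges p. ?x $ e)"
    if "path_edges p \<subseteq> E" "p \<noteq> []" "{hd p, last p} \<in> E \<union> F" for p
  proof (cases "\<exists>e\<in>path_edges p. ?x $ e = 1")
    case True
    then obtain e where e: "e \<in> path_edges p" "?x $ e = 1" by blast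
    have "?x $ e \<le> (\<Sum>e\<in>path_edges p. ?x $ e)"
      using e x_nonneg by (intro member_le_sum) auto
    then show ?thesis using e x_le1[of "{hd p, last p}"] by linarith
  next
    case False
    then have "same a b" if "{a, b} \<in> path_edges p" for a b
      using that x01 x0[of a b] \<open>path_edges p \<subseteq> E\<close> by blast
    then have "same (hd p) (last p)"
      using path_ends_related[of p same] \<open>reflp same\<close> \<open>transp same\<close> that by blast
    then have "?x $ {hd p, last p} = 0" using x0 that by blast
    then show ?thesis using x_nonneg by (simp add: sum_nonneg)
  qed
  show ?thesis
    unfolding lifted_multicuts_def
  proof (intro CollectI conjI allI impI ballI)
    fix e assume "e \<in> E \<union> F"
    then show "?x $ e \<in> {0, 1}" using x01 by auto
  next
    fix e assume "e \<notin> E \<union> F"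
    then show "?x $ e = 0" by (simp add: multicut_def)
  next
    fix c e assume c: "is_cycle V E c" and e: "e \<in> cycle_edges c"
    obtain d where d: "is_cycle V E d" "cycle_edges d = cycle_edges c" "e = {last d, hd d}"
      using cycle_closing_edge[OF e c] .
    have "cycle_edges c - {e} = path_edges d"
      using d closing_edge_notin_path_edges[OF d(1)] unfolding d(2)[symmetric]
      by (auto simp: cycle_edges_def)
    moreover have "path_edges d \<subseteq> E" "{hd d, last d} \<in> E \<union> F" "d \<noteq> []"
      using d(1) by (auto simp: is_cycle_def cycle_edges_def insert_commute)
    ultimately show "?x $ e \<le> (\<Sum>e'\<in>cycle_edges c - {e}. ?x $ e')"
      using path[of d] d(3) by (simp add: insert_commute)
  next
    fix u w p assume *: "{u, w} \<in> F \<and> is_path_between V E u w p"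
    then show "?x $ {u, w} \<le> (\<Sum>e\<in>path_edges p. ?x $ e)"
      using path[of p] by (auto simp: is_path_between_def is_path_def)
  next
    fix u w C assume *: "{u, w} \<in> F \<and> is_cut_between V E u w C"
    then obtain U where U: "u \<in> U" "w \<notin> U" "C = cut_edges E U"
      by (auto simp: is_cut_between_def)
    have nonneg: "0 \<le> (\<Sum>e\<in>C. 1 - ?x $ e)" using x_le1 by (simp add: sum_nonneg)
    show "1 - ?x $ {u, w} \<le> (\<Sum>e\<in>C. 1 - ?x $ e)"
    proof (cases "same u w")
      case True
      then obtain A where A: "A \<in> K" "u \<in> A" "w \<in> A" using U by (auto simp: same_def)
      then have "reach E A u w" using K by (auto simp: clustering_def conn_def)
      then obtain s t where st: "s \<in> U \<inter> A" "t \<in> A - U" "{s, t} \<in> E"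
        using reach_crosses[OF _ U(1,2)] by blast
      have "{s, t} \<inter> U = {s}" using st by auto
      then have "{s, t} \<in> C" using st U by (auto simp: cut_edges_def)
      then have "1 - ?x $ {s, t} \<le> (\<Sum>e\<in>C. 1 - ?x $ e)"
        using x_le1 by (intro member_le_sum) auto
      moreover have "?x $ {s, t} = 0"
        using st A by (auto simp: multicut_def)
      ultimately show ?thesis using x_nonneg[of "{u, w}"] by linarith
    next
      case False
      then have "?x $ {u, w} = 1" using x0[of u w] x01 * by auto
      then show ?thesis using nonneg by simp
    qed
  qed
qed

lemma conn_path:
  assumes "path_edges p \<subseteq> E"
  shows "conn E (set p)"
proof -
  have *: "reach E (set p) (p ! i) (p ! j)" if "i \<le> j" "j < length p" for i j
    using reach_path_nth[OF assms that] set_take_subset[of "Suc j" p]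
    by (rule reach_mono)
  have "reach E (set p) (p ! i) (p ! j)" if "i < length p" "j < length p" for i j
    using *[of i j] *[of j i] that by (cases "i \<le> j") (auto intro: reach_sym)
  then show ?thesis by (auto simp: conn_def in_set_conv_nth)
qed

text \<open>Orthogonality to a multicut thus says that the weight of \<open>c\<close> inside the
  clusters equals its total weight on \<open>D\<close>.\<close>

lemma inner_multicut:
  "c \<bullet> multicut D K = (\<Sum>e\<in>D. c $ e) - (\<Sum>e | e \<in> D \<and> (\<exists>A\<in>K. e \<subseteq> A). c $ e)"
proof -
  have "c \<bullet> multicut D K = (\<Sum>e\<in>UNIV. if e \<in> D \<and> \<not> (\<exists>A\<in>K. e \<subseteq> A) then c $ e else 0)"
    by (auto simp: inner_vec_def multicut_def intro!: sum.cong)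
  also have "\<dots> = (\<Sum>e | e \<in> D \<and> \<not> (\<exists>A\<in>K. e \<subseteq> A). c $ e)"
    by (simp add: sum.If_cases)
  also have "\<dots> = (\<Sum>e\<in>D - {e. e \<in> D \<and> (\<exists>A\<in>K. e \<subseteq> A)}. c $ e)"
    by (rule sum.cong) auto
  also have "\<dots> = (\<Sum>e\<in>D. c $ e) - (\<Sum>e | e \<in> D \<and> (\<exists>A\<in>K. e \<subseteq> A). c $ e)"
    by (rule sum_diff) auto
  finally show ?thesis .
qed

lemma simple_graph_edgeE:
  assumes "simple_graph V D" "e \<in> D"
  obtains a b where "e = {a, b}" "a \<noteq> b" "a \<in> V" "b \<in> V"
  using assms by (auto simp: simple_graph_def card_2_iff)

lemma simple_graph_pairD:
  assumes "simple_graph V D" "{a, b} \<in> D"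
  shows "a \<noteq> b" "a \<in> V" "b \<in> V"
  using simple_graph_edgeE[OF assms] by (auto simp: doubleton_eq_iff)

lemma is_path_slice:
  assumes "is_path V E p" "i < j" "j < length p"
  shows "is_path V E (drop i (take (Suc j) p))"
    and "hd (drop i (take (Suc j) p)) = p ! i"
    and "last (drop i (take (Suc j) p)) = p ! j"
proof -
  show "is_path V E (drop i (take (Suc j) p))"
    using assms path_edges_drop[of i "take (Suc j) p"] path_edges_take[of "Suc j" p]
      set_drop_subset[of i "take (Suc j) p"] set_take_subset[of "Suc j" p]
    unfolding is_path_def by auto
qed (use assms in \<open>simp_all add: hd_drop_conv_nth last_conv_nth\<close>)

text \<open>Comparing the clusterings \<open>{Q}\<close> and \<open>{Q, set p}\<close> shows that
  the weight inside \<open>set p\<close> is zero. Every pair of \<open>D\<close> inside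
  \<open>set p\<close> other than the end pair joins the ends of a shorter subpath, so by induction
  only the end pair contributes.\<close>

lemma orthogonal_outside_cluster:
  fixes c :: "real ^ ('v::finite set)"
  assumes D: "simple_graph V D"
    and Q: "Q \<subseteq> V" "conn E Q"
    and orth: "\<And>K. clustering V E K \<Longrightarrow> Q \<in> K \<Longrightarrow> c \<bullet> multicut D K = 0"
  shows "is_path (V - Q) E p \<Longrightarrow> {hd p, last p} \<in> D \<Longrightarrow> c $ {hd p, last p} = 0"
proof (induction p rule: length_induct)
  case (1 p)
  then have p: "p \<noteq> []" "distinct p" "set p \<subseteq> V - Q" "path_edges p \<subseteq> E"
    by (auto simp: is_path_def)
  let ?in = "\<lambda>A. {e \<in> D. e \<subseteq> A}"
  have "clustering V E {Q}" "clustering V E {Q, set p}"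
    using Q p conn_path[OF p(4)] by (auto simp: clustering_def disjoint_def)
  then have "c \<bullet> multicut D {Q} = 0" "c \<bullet> multicut D {Q, set p} = 0" using orth by auto
  then have *: "(\<Sum>e\<in>{e \<in> D. e \<subseteq> Q \<or> e \<subseteq> set p}. c $ e) = (\<Sum>e\<in>?in Q. c $ e)"
    by (simp add: inner_multicut)
  have "{e \<in> D. e \<subseteq> Q \<or> e \<subseteq> set p} = ?in Q \<union> ?in (set p)" by auto
  moreover have "?in Q \<inter> ?in (set p) = {}"
    using p(3) by (auto elim!: simple_graph_edgeE[OF D])
  ultimately have sum0: "(\<Sum>e\<in>?in (set p). c $ e) = 0"
    using * by (simp add: sum.union_disjoint)
  have rest: "c $ e = 0" if e: "e \<in> D" "e \<subseteq> set p" "e \<noteq> {hd p, last p}" for e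
  proof -
    obtain a b where ab: "e = {a, b}" "a \<noteq> b" using simple_graph_edgeE[OF D e(1)] by metis
    with e obtain i' j' where "i' < length p" "j' < length p" "p ! i' = a" "p ! j' = b"
      by (auto simp: in_set_conv_nth)
    with ab obtain i j where ij: "i < j" "j < length p" "e = {p ! i, p ! j}"
      by (cases i' j' rule: linorder_cases) (auto simp: insert_commute)
    let ?q = "drop i (take (Suc j) p)"
    have "\<not> (i = 0 \<and> j = length p - 1)"
      using e(3) ij p(1) by (auto simp: hd_conv_nth last_conv_nth)
    then have "length ?q < length p" using ij by auto
    moreover note is_path_slice[OF "1.prems"(1) ij(1,2)]
    ultimately show ?thesis using "1.IH" ij(3) e(1) by metis
  qed
  have "{hd p, last p} \<in> ?in (set p)" using 1 p(1) by auto
  then have "(\<Sum>e\<in>?in (set p). c $ e) = c $ {hd p, last p} + (\<Sum>e\<in>?in (set p) - {{hd p, last p}}. c $ e)"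
    by (intro sum.remove) auto
  also have "(\<Sum>e\<in>?in (set p) - {{hd p, last p}}. c $ e) = 0"
    using rest by (intro sum.neutral) auto
  finally show ?case using sum0 by simp
qed

text \<open>This is the case of the empty cluster \<open>Q\<close>; it yields that the polytope is
  full-dimensional in the coordinates \<open>E \<union> F\<close>.\<close>

lemma orthogonal_lifted_multicuts:
  fixes c :: "real ^ ('v::finite set)"
  assumes G: "connected_graph V E" and D: "simple_graph V (E \<union> F)"
    and orth: "\<And>x. x \<in> lifted_multicuts V E F \<Longrightarrow> c \<bullet> x = 0"
    and f: "f \<in> E \<union> F"
  shows "c $ f = 0"
proof -
  obtain a b where ab: "f = {a, b}" "a \<in> V" "b \<in> V" using simple_graph_edgeE[OF D f] by metis
  then obtain p where "is_path_between V E a b p" using G by (auto simp: connected_graph_def)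
  then have p: "is_path (V - {}) E p" "f = {hd p, last p}" using ab by (auto simp: is_path_between_def)
  have "c \<bullet> multicut (E \<union> F) K = 0" if "clustering V E K" for K
    using orth multicut_mem[OF D that] by blast
  then show ?thesis
    using orthogonal_outside_cluster[OF D, of "{}" E c p] p f by (auto simp: conn_def)
qed

section \<open>Facets and orthogonal vectors\<close>

lemma aff_dim_eq_dim_span:
  fixes S :: "'a::euclidean_space set"
  assumes "0 \<in> S"
  shows "aff_dim S = int (dim (span S))"
  using assms by (simp add: aff_dim_zero hull_inc)

text \<open>If the span were smaller, the coordinate subspace would contain a nonzero vector
  orthogonal to it. Its entries in \<open>D\<close> vanish by the second assumption, the others by
  membership in the subspace.\<close>

lemma span_eq_coordinate_subspace:
  fixes S :: "(real ^ 'n) set"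
  assumes "\<And>x e. x \<in> S \<Longrightarrow> e \<notin> D \<Longrightarrow> x $ e = 0"
    and "\<And>c f. (\<And>x. x \<in> S \<Longrightarrow> c \<bullet> x = 0) \<Longrightarrow> f \<in> D \<Longrightarrow> c $ f = 0"
  shows "span S = {x. \<forall>e. e \<notin> D \<longrightarrow> x $ e = 0}" (is "_ = ?W")
proof (rule ccontr)
  have W: "subspace ?W" by (auto simp: subspace_def)
  assume "span S \<noteq> ?W"
  moreover have "span S \<subseteq> ?W" using assms(1) by (intro span_minimal W) auto
  moreover have spanW: "span ?W = ?W" using W by (rule span_eq_iff[THEN iffD2])
  ultimately have "span S \<subset> span ?W" by blast
  then obtain c where c: "c \<noteq> 0" "c \<in> span ?W" "\<And>y. y \<in> span S \<Longrightarrow> orthogonal c y"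
    using orthogonal_to_subspace_exists_gen by blast
  have "c $ f = 0" for f
  proof (cases "f \<in> D")
    case True
    have "c \<bullet> x = 0" if "x \<in> S" for x using c(3)[OF span_base[OF that]] by (simp add: orthogonal_def)
    with True show ?thesis by (intro assms(2)) auto
  qed (use c(2) spanW in blast)
  with c(1) show False by (simp add: vec_eq_iff)
qed

lemma finite_lifted_multicuts:
  fixes V :: "'v::finite set"
  shows "finite (lifted_multicuts V E F)"
proof -
  have "lifted_multicuts V E F \<subseteq> (\<lambda>S. \<chi> e. if e \<in> S then 1 else 0) ` UNIV"
  proof
    fix x assume x: "x \<in> lifted_multicuts V E F"
    have "x $ e = 0 \<or> x $ e = 1" for e
      using x by (cases "e \<in> E \<union> F") (auto simp: lifted_multicuts_def)
    then have "x = (\<chi> e. if e \<in> {e. x $ e = 1} then 1 else 0)"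
      by (auto simp: vec_eq_iff)
    then show "x \<in> (\<lambda>S. \<chi> e. if e \<in> S then 1 else 0) ` UNIV" by blast
  qed
  then show ?thesis by (rule finite_subset) simp
qed

lemma zero_mem_lifted_multicuts:
  assumes G: "connected_graph V E" and D: "simple_graph V (E \<union> F)"
  shows "0 \<in> lifted_multicuts V E F"
proof -
  have "clustering V E {V}"
    using G by (auto simp: clustering_def conn_def connected_graph_def reach_iff_path disjoint_def)
  moreover have "multicut (E \<union> F) {V} = 0"
    using D by (auto simp: vec_eq_iff multicut_def simple_graph_def)
  ultimately show ?thesis using multicut_mem[OF D] by metis
qed

text \<open>Polytope and face both contain the origin, so affine dimensions are dimensions of linear
  spans. The polytope spans all coordinates of \<open>E \<union> F\<close>, so the face is a facet
  iff its points span all coordinates but \<open>h\<close>; the right-hand side is the dual form of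
  this.\<close>

lemma facet_defining_iff_orthogonal:
  fixes V :: "'v::finite set"
  assumes G: "connected_graph V E" and D: "simple_graph V (E \<union> F)" and h: "h \<in> E \<union> F"
  shows "facet_defining (- axis h 1) 0 (lifted_multicut_polytope V E F) \<longleftrightarrow>
    (\<forall>c. (\<forall>x\<in>lifted_multicuts V E F. x $ h = 0 \<longrightarrow> c \<bullet> x = 0) \<longrightarrow> (\<forall>f\<in>E \<union> F - {h}. c $ f = 0))"
    (is "_ \<longleftrightarrow> ?R")
proof -
  let ?X = "lifted_multicuts V E F"
  let ?Y = "{x \<in> ?X. x $ h = 0}"
  let ?P = "convex hull ?X"
  let ?T = "{x \<in> ?P. (- axis h 1) \<bullet> x = 0}"
  let ?W = "\<lambda>D. {x :: real ^ ('v set). \<forall>e. e \<notin> D \<longrightarrow> x $ e = 0}"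
  have dimW: "dim (?W B) = card B" for B
    using dim_substandard_cart[where 'a = real] unfolding dim_vec_eq .
  have subspW: "subspace (?W B)" for B by (auto simp: subspace_def)
  have outside: "x $ e = 0" if "x \<in> ?X" "e \<notin> E \<union> F" for x e
    using that by (auto simp: lifted_multicuts_def)
  have nonneg: "(- axis h 1) \<bullet> x \<le> 0" if "x \<in> ?P" for x
  proof -
    have "x $ h \<in> {0, 1}" if "x \<in> ?X" for x
      using h that unfolding lifted_multicuts_def by blast
    then have "?X \<subseteq> {x. (- axis h 1) \<bullet> x \<le> 0}"
      unfolding lower_box_inequality by force
    then have "?P \<subseteq> {x. (- axis h 1) \<bullet> x \<le> 0}"
      by (intro hull_minimal convex_halfspace_le)
    with that show ?thesis by blast
  qed
  have zero: "0 \<in> ?X" by (rule zero_mem_lifted_multicuts[OF G D])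
  then have zeroP: "0 \<in> ?P" by (simp add: hull_inc)
  have face: "?T face_of ?P"
    using face_of_Int_supporting_hyperplane_le[of ?P "- axis h 1" 0] nonneg convex_convex_hull
    by (simp add: Int_def conj_commute)
  have "compact ?X" by (simp add: finite_imp_compact finite_lifted_multicuts)
  \<comment> \<open>A face of the hull of a compact set is the hull of some of its points. These
    points satisfy \<open>x $ h = 0\<close>, so \<open>?T\<close> and \<open>?Y\<close> have the
    same span.\<close>
  then obtain S where S: "S \<subseteq> ?X" "?T = convex hull S"
    by (rule face_of_convex_hull_subset[OF _ face])
  have YT: "?Y \<subseteq> ?T" by (auto simp: hull_inc inner_axis')
  have "S \<subseteq> ?Y"
    using S hull_subset[of S convex] by (auto simp: inner_axis')
  then have "?T \<subseteq> span ?Y"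
    unfolding S(2) by (rule subset_trans[OF hull_mono convex_hull_subset_span])
  with YT have spanT: "span ?T = span ?Y"
    by (intro subset_antisym span_mono[OF YT] span_minimal subspace_span)
  have "span ?P = span ?X"
    by (intro subset_antisym span_mono span_minimal subspace_span convex_hull_subset_span hull_subset)
  also have "\<dots> = ?W (E \<union> F)"
    using outside orthogonal_lifted_multicuts[OF G D] by (intro span_eq_coordinate_subspace) auto
  finally have dimP: "aff_dim ?P = int (card (E \<union> F))"
    by (simp only: aff_dim_eq_dim_span[OF zeroP] dimW)
  have zeroT: "0 \<in> ?T" using zeroP by simp
  have subW: "span ?Y \<subseteq> ?W (E \<union> F - {h})"
    using outside by (intro span_minimal) (auto simp: subspace_def)
  have "facet_defining (- axis h 1) 0 ?P \<longleftrightarrow> aff_dim ?T = aff_dim ?P - 1"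
    using nonneg face zeroT by (auto simp: facet_defining_def facet_of_def)
  \<comment> \<open>Since \<open>h\<close> lies in \<open>E \<union> F\<close>, the cardinality is
    positive and subtraction on naturals agrees with that on integers.\<close>
  also have "\<dots> \<longleftrightarrow> dim (span ?Y) = card (E \<union> F - {h})"
    using aff_dim_eq_dim_span[OF zeroT] dimP h card_gt_0_iff[of "E \<union> F"]
    unfolding spanT by (auto simp: card_Diff_singleton)
  also have "\<dots> \<longleftrightarrow> span ?Y = ?W (E \<union> F - {h})"
  proof
    assume "dim (span ?Y) = card (E \<union> F - {h})"
    then show "span ?Y = ?W (E \<union> F - {h})"
      using subW by (intro subspace_dim_equal subspace_span subspW) (simp_all only: dimW order_refl)
  next
    assume "span ?Y = ?W (E \<union> F - {h})"
    then show "dim (span ?Y) = card (E \<union> F - {h})"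
      by (simp only: dimW)
  qed
  also have "\<dots> \<longleftrightarrow> ?R"
  proof
    assume eq: "span ?Y = ?W (E \<union> F - {h})"
    show ?R
    proof (intro allI impI ballI)
      fix c f assume c: "\<forall>x\<in>?X. x $ h = 0 \<longrightarrow> c \<bullet> x = 0" and f: "f \<in> E \<union> F - {h}"
      have "axis f 1 \<in> span ?Y" using f unfolding eq by (auto simp: axis_def)
      moreover have "span ?Y \<subseteq> {x. c \<bullet> x = 0}"
        using c by (intro span_minimal subspace_hyperplane) auto
      ultimately show "c $ f = 0" by (auto simp: inner_axis)
    qed
  next
    assume ?R
    then show "span ?Y = ?W (E \<union> F - {h})"
      using outside by (intro span_eq_coordinate_subspace) auto
  qed
  finally show ?thesis by (simp add: lifted_multicut_polytope_def)
qed

section \<open>Vectors orthogonal to the face\<close>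

lemma conn_insert:
  assumes "conn E A" "a \<in> A" "{a, s} \<in> E"
  shows "conn E (insert s A)"
proof -
  have *: "reach E (insert s A) a x" if "x \<in> insert s A" for x
  proof (cases "x = s")
    case True
    with assms show ?thesis by (auto intro: reach_edge)
  next
    case False
    with assms that have "reach E A a x" by (auto simp: conn_def)
    then show ?thesis by (auto intro: reach_mono)
  qed
  show ?thesis
    unfolding conn_def
  proof (intro ballI)
    fix x y assume "x \<in> insert s A" "y \<in> insert s A"
    then show "reach E (insert s A) x y"
      using reach_trans[OF *[of y] reach_sym[OF *[of x]]] by blast
  qed
qed

lemma reach_in_component:
  "reach E U a b \<Longrightarrow> reach E {v. reach E U a v} a b"
proof (induction rule: reach.induct)
  case base: reach_refl
  then show ?case by (auto intro: reach.intros)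
next
  case step: (reach_step b c)
  then have "reach E U a c" by (blast intro: reach_step)
  with step show ?case by (auto intro: reach_step)
qed

lemma conn_component: "conn E {v. reach E U a v}"
  unfolding conn_def
proof (intro ballI)
  fix x y assume "x \<in> {v. reach E U a v}" "y \<in> {v. reach E U a v}"
  then have "reach E {v. reach E U a v} a x" "reach E {v. reach E U a v} a y"
    by (simp_all add: reach_in_component)
  then show "reach E {v. reach E U a v} x y" by (blast intro: reach_trans reach_sym)
qed

text \<open>Clusterings with \<open>u\<close> and \<open>w\<close> in one cluster supply the points
  of the face that are used for testing \<open>c\<close>.\<close>

locale orthogonal_vector =
  fixes V :: "'v::finite set" and E D :: "'v set set" and u w :: 'v and c :: "real ^ ('v set)"
  assumes G: "connected_graph V E" and D: "simple_graph V D" and u: "u \<in> V" and w: "w \<in> V"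
    and orth: "\<And>K A. clustering V E K \<Longrightarrow> A \<in> K \<Longrightarrow> u \<in> A \<Longrightarrow> w \<in> A \<Longrightarrow>
      c \<bullet> multicut D K = 0"
begin

lemma reach_V: "a \<in> V \<Longrightarrow> b \<in> V \<Longrightarrow> reach E V a b"
  using G by (simp add: connected_graph_def reach_iff_path)

text \<open>All connected sets containing \<open>u\<close> and \<open>w\<close> carry the same
  weight, so comparing nested ones isolates single edges or the edges at a node.\<close>

lemma weight_cluster:
  assumes "conn E A" "A \<subseteq> V" "u \<in> A" "w \<in> A"
  shows "(\<Sum>e | e \<in> D \<and> e \<subseteq> A. c $ e) = (\<Sum>e\<in>D. c $ e)"
proof -
  have "clustering V E {A}" using assms by (simp add: clustering_def disjoint_def)
  then have "c \<bullet> multicut D {A} = 0" using assms by (intro orth) auto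
  then show ?thesis by (simp add: inner_multicut)
qed

lemma nonseparator_zero:
  assumes st: "{s, t} \<in> D" and nonsep: "\<not> is_separator V E u w {s, t}"
  shows "c $ {s, t} = 0"
proof -
  \<comment> \<open>The set \<open>A\<close> below is the component of \<open>u\<close> after
    deleting \<open>s\<close> and \<open>t\<close>; it contains \<open>w\<close> because
    \<open>{s, t}\<close> does not separate.\<close>
  have "card {s, t} = 2" "{s, t} \<subseteq> V" using D st by (auto simp: simple_graph_def)
  then have stV: "s \<in> V" "t \<in> V" "s \<noteq> t" by auto
  define A where "A = {v. reach E (V - {s, t}) u v}"
  have "reach E (V - {s, t}) u w" using nonsep stV by (simp add: is_separator_iff)
  then have uwA: "u \<in> A" "w \<in> A" by (auto simp: A_def intro: reach_refl dest: reach_mem)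
  have AV: "A \<subseteq> V - {s, t}" by (auto simp: A_def dest: reach_mem)
  have connA: "conn E A" unfolding A_def by (rule conn_component)
  have closed: "v \<in> A" if "a \<in> A" "{a, v} \<in> E" "v \<in> V - {s, t}" for a v
    using that by (auto simp: A_def intro: reach_step)
  \<comment> \<open>If \<open>y\<close> were unreachable from \<open>x\<close> outside
    \<open>A\<close>, the component of \<open>x\<close> there would have an edge into
    \<open>A\<close>, as the graph is connected. Since \<open>A\<close> is closed under neighbours
    other than \<open>s\<close> and \<open>t\<close>, that edge would start at \<open>x\<close>,
    which has no neighbour in \<open>A\<close>.\<close>
  have far: "c $ {x, y} = 0"
    if xy: "{x, y} = {s, t}" "\<not> (\<exists>a\<in>A. {a, x} \<in> E)" for x y
  proof -
    have xyV: "x \<in> V - A" "y \<in> V - A" using xy(1) stV AV by (auto simp: doubleton_eq_iff)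
    have "reach E (V - A) x y"
    proof (rule ccontr)
      assume no: "\<not> reach E (V - A) x y"
      let ?B = "{v. reach E (V - A) x v}"
      obtain s' t' where s't': "s' \<in> ?B" "t' \<in> V - ?B" "{s', t'} \<in> E"
        using reach_crosses[of E V x y ?B] reach_V xyV no by (auto intro: reach_refl)
      then have "t' \<in> A" by (auto intro: reach_step)
      moreover have "s' \<in> V - A" using s't'(1) by (auto dest: reach_mem)
      moreover have "{t', s'} \<in> E" using s't'(3) by (simp add: insert_commute)
      ultimately have "s' \<in> {x, y}" using closed[of t' s'] xy(1) by auto
      with s't'(1) no have "s' = x" by auto
      with xy(2) \<open>t' \<in> A\<close> \<open>{t', s'} \<in> E\<close> show False by auto
    qed
    then obtain p where "is_path_between (V - A) E x y p" using path_of_reach by metis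
    then have p: "is_path (V - A) E p" "hd p = x" "last p = y" by (auto simp: is_path_between_def)
    have "c $ {hd p, last p} = 0"
      using AV uwA p st xy(1)
      by (intro orthogonal_outside_cluster[OF D _ connA orth]) auto
    then show ?thesis using p by simp
  qed
  let ?N = "\<lambda>S. {e \<in> D. e \<subseteq> S}"
  \<comment> \<open>If \<open>A\<close> is adjacent to both ends, \<open>c\<^bsub>st\<^esub>\<close> is the second difference of the constant weight
    of clusters containing \<open>A\<close>; otherwise \<open>st\<close> is joined by a path avoiding \<open>A\<close>.\<close>
  show ?thesis
  proof (cases "(\<exists>a\<in>A. {a, s} \<in> E) \<and> (\<exists>a\<in>A. {a, t} \<in> E)")
    case True
    then obtain a b where ab: "a \<in> A" "{a, s} \<in> E" "b \<in> A" "{b, t} \<in> E" by blast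
    have conns: "conn E (insert s A)" "conn E (insert t A)" "conn E (insert s (insert t A))"
      using conn_insert connA ab by (metis insertCI)+
    then have weights: "(\<Sum>e\<in>?N S. c $ e) = (\<Sum>e\<in>D. c $ e)"
      if "S \<in> {A, insert s A, insert t A, insert s (insert t A)}" for S
      using that connA AV stV uwA by (auto intro!: weight_cluster)
    have "?N (insert s A) \<inter> ?N (insert t A) = ?N A"
      using AV stV by blast
    moreover have "?N (insert s (insert t A)) = insert {s, t} (?N (insert s A) \<union> ?N (insert t A))"
    proof (intro set_eqI iffI)
      fix e assume "e \<in> ?N (insert s (insert t A))"
      then show "e \<in> insert {s, t} (?N (insert s A) \<union> ?N (insert t A))"
        using simple_graph_edgeE[OF D, of e] by (auto simp: insert_commute)
    qed (use st in auto)
    moreover have "{s, t} \<notin> ?N (insert s A) \<union> ?N (insert t A)" using AV stV by auto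
    ultimately have "(\<Sum>e\<in>?N (insert s (insert t A)). c $ e) + (\<Sum>e\<in>?N A. c $ e) =
        c $ {s, t} + (\<Sum>e\<in>?N (insert s A). c $ e) + (\<Sum>e\<in>?N (insert t A). c $ e)"
      using sum.union_inter[of "?N (insert s A)" "?N (insert t A)" "($) c"] by simp
    then show ?thesis using weights by simp
  next
    case False
    then show ?thesis using far[of s t] far[of t s] by (auto simp: insert_commute)
  qed
qed

text \<open>Let \<open>A\<close> be the component of \<open>u\<close> after deleting
  \<open>b\<close>; it contains \<open>w\<close>. The sets \<open>A\<close> and
  \<open>insert b A\<close> have equal weight, so the edges from \<open>b\<close> into
  \<open>A\<close> sum to zero. An edge from \<open>b\<close> to a node outside \<open>A\<close>
  does not separate and has entry 0.\<close>

lemma sum_incident_zero: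
  assumes b: "b \<in> V" "\<not> is_cut_node V E u w b"
  shows "(\<Sum>e | e \<in> D \<and> b \<in> e. c $ e) = 0"
proof -
  define A where "A = {v. reach E (V - {b}) u v}"
  have "reach E (V - {b}) u w" using b by (simp add: is_cut_node_iff)
  then have uwA: "u \<in> A" "w \<in> A" by (auto simp: A_def intro: reach_refl dest: reach_mem)
  have AV: "A \<subseteq> V - {b}" by (auto simp: A_def dest: reach_mem)
  have connA: "conn E A" unfolding A_def by (rule conn_component)
  \<comment> \<open>By connectivity some edge leaves \<open>A\<close>, and it can only lead to
    \<open>b\<close>.\<close>
  obtain a t where at: "a \<in> A" "t \<in> V - A" "{a, t} \<in> E"
    using reach_crosses[of E V u b A] reach_V[OF u b(1)] uwA AV by blast
  then have "t = b" by (auto simp: A_def intro: reach_step)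
  with at have connb: "conn E (insert b A)" using conn_insert[OF connA] by blast
  let ?N = "\<lambda>S. {e \<in> D. e \<subseteq> S}"
  let ?B = "{e \<in> D. e \<subseteq> insert b A \<and> b \<in> e}"
  have "(\<Sum>e\<in>?N (insert b A). c $ e) = (\<Sum>e\<in>?N A. c $ e)"
    using weight_cluster[OF connA] weight_cluster[OF connb] uwA subset_trans[OF AV Diff_subset] b
    by auto
  moreover have "?N (insert b A) = ?N A \<union> ?B" by blast
  moreover have "?N A \<inter> ?B = {}" using AV by auto
  ultimately have "(\<Sum>e\<in>?B. c $ e) = 0" by (simp add: sum.union_disjoint)
  moreover have "(\<Sum>e\<in>?B. c $ e) = (\<Sum>e | e \<in> D \<and> b \<in> e. c $ e)"
  proof (rule sum.mono_neutral_left)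
    show "\<forall>e\<in>{e. e \<in> D \<and> b \<in> e} - ?B. c $ e = 0"
    proof
      fix e assume e: "e \<in> {e. e \<in> D \<and> b \<in> e} - ?B"
      then obtain x where x: "e = {x, b}" "x \<notin> A"
        using simple_graph_edgeE[OF D, of e] by (auto simp: insert_commute)
      have "reach E A u w" using connA uwA by (auto simp: conn_def)
      then have "reach E (V - {x, b}) u w" using AV x by (elim reach_mono) auto
      then have "\<not> is_separator V E u w {x, b}" by (simp add: is_separator_iff)
      then show "c $ e = 0" using nonseparator_zero e x by auto
    qed
  qed auto
  ultimately show ?thesis by simp
qed

end

text \<open>If the first node of a longest path is not terminal, it has a second edge. The other end
  of that edge either lies on the path and closes a cycle, or prolongs the path.\<close>

lemma cycle_or_terminal_end:
  assumes p: "is_path V S p" "length p \<ge> 2"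
    and S: "simple_graph V S"
    and longest: "\<And>q. is_path V S q \<Longrightarrow> length q \<le> length p"
    and deg: "\<And>b e. b \<in> V \<Longrightarrow> \<not> T b \<Longrightarrow> e \<in> S \<Longrightarrow> b \<in> e \<Longrightarrow> \<exists>e'\<in>S. e' \<noteq> e \<and> b \<in> e'"
    and no_cycle: "\<nexists>c. is_cycle V S c"
  shows "T (hd p)"
proof (rule ccontr)
  assume "\<not> T (hd p)"
  obtain a b r where r: "p = a # b # r" using p(2) by (cases p; cases "tl p") auto
  have ab: "{a, b} \<in> S" "a \<in> V" using p r by (auto simp: is_path_def)
  then obtain e where e: "e \<in> S" "e \<noteq> {a, b}" "a \<in> e"
    using deg[of a "{a, b}"] \<open>\<not> T (hd p)\<close> r by auto
  then obtain d where d: "e = {d, a}" "d \<noteq> a" "d \<in> V" "d \<noteq> b"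
    using simple_graph_edgeE[OF S e(1)] by (metis doubleton_eq_iff insertE singletonD)
  show False
  proof (cases "d \<in> set p")
    case True
    then obtain j where j: "j < length p" "p ! j = d" by (auto simp: in_set_conv_nth)
    \<comment> \<open>The node \<open>d\<close> differs from the first two nodes \<open>a\<close>
      and \<open>b\<close>, so the prefix ending in \<open>d\<close> has at least three
      nodes.\<close>
    with d r have "j \<ge> 2" by (cases j; cases "j - 1") auto
    let ?c = "take (Suc j) p"
    have "hd ?c = a" using r by simp
    moreover have "last ?c = d" using j by (simp add: take_Suc_conv_app_nth)
    moreover have "length ?c \<ge> 3" "distinct ?c" using p(1) j \<open>j \<ge> 2\<close> by (auto simp: is_path_def)
    moreover have "path_edges ?c \<subseteq> S" "set ?c \<subseteq> V"
      using p(1) path_edges_take[of "Suc j" p] set_take_subset[of "Suc j" p]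
      unfolding is_path_def by blast+
    ultimately have "is_cycle V S ?c"
      using e d unfolding is_cycle_def cycle_edges_def by auto
    with no_cycle show False by blast
  next
    case False
    then have "is_path V S (d # p)"
      using p d e r by (auto simp: is_path_def)
    then show False using longest by fastforce
  qed
qed

text \<open>A longest path exists because lengths are bounded by \<open>card V\<close>; the argument
  for its first node is applied to it and to its reverse.\<close>

lemma cycle_or_terminal_path:
  assumes S: "simple_graph V S" and "S \<noteq> {}"
    and deg: "\<And>b e. b \<in> V \<Longrightarrow> \<not> T b \<Longrightarrow> e \<in> S \<Longrightarrow> b \<in> e \<Longrightarrow> \<exists>e'\<in>S. e' \<noteq> e \<and> b \<in> e'"
    and no_cycle: "\<nexists>c. is_cycle V S c"
  shows "\<exists>p. is_path V S p \<and> length p \<ge> 2 \<and> T (hd p) \<and> T (last p)"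
proof -
  obtain e where "e \<in> S" using \<open>S \<noteq> {}\<close> by auto
  then obtain a b where "e = {a, b}" "a \<noteq> b" "a \<in> V" "b \<in> V"
    using simple_graph_edgeE[OF S] by metis
  with \<open>e \<in> S\<close> have ab: "is_path V S [a, b]" by (simp add: is_path_def)
  have "finite V" using S by (simp add: simple_graph_def)
  then have bound: "length q < Suc (card V)" if "is_path V S q" for q
    using that by (auto simp: is_path_def less_Suc_eq_le distinct_card[symmetric] intro: card_mono)
  obtain p where p: "is_path V S p" "\<And>q. is_path V S q \<Longrightarrow> length q \<le> length p"
    using ex_has_greatest_nat[of "is_path V S" "[a, b]" length "Suc (card V)"] ab bound
    by (metis less_imp_le)
  have len: "length p \<ge> 2" using p(2)[OF ab] by simp
  have "is_path V S (rev p)" using p(1) by (simp add: is_path_def path_edges_rev)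
  then have "T (hd (rev p))"
    using cycle_or_terminal_end[OF _ _ S _ deg no_cycle, of "rev p"] p len by auto
  moreover have "T (hd p)" using cycle_or_terminal_end[OF p(1) len S p(2) deg no_cycle] .
  ultimately show ?thesis using p(1) len by (auto simp: hd_rev)
qed

section \<open>Paths and cycles of separating edges\<close>

text \<open>The set \<open>U\<close> consists of the nodes reachable from \<open>u\<close> along
  edges of \<open>E\<close> with value 0. Path and cycle inequalities force 0 inside
  \<open>U\<close>, cut inequalities force 1 on its boundary.\<close>

lemma zero_edge_component:
  fixes V :: "'v::finite set"
  assumes D: "simple_graph V (E \<union> F)" and x: "x \<in> lifted_multicuts V E F"
    and uw: "{u, w} \<in> E \<union> F" "x $ {u, w} = 0"
  obtains U where "U \<subseteq> V" "reach E U u w"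
    "\<And>a b. {a, b} \<in> E \<union> F \<Longrightarrow> a \<in> U \<Longrightarrow> b \<in> U \<Longrightarrow> x $ {a, b} = 0"
    "\<And>a b. {a, b} \<in> E \<union> F \<Longrightarrow> a \<in> U \<Longrightarrow> b \<notin> U \<Longrightarrow> x $ {a, b} = 1"
proof -
  have x01: "x $ e = 0 \<or> x $ e = 1" if "e \<in> E \<union> F" for e
    using x that unfolding lifted_multicuts_def by blast
  have cyc: "x $ e \<le> (\<Sum>e'\<in>cycle_edges c - {e}. x $ e')" if "is_cycle V E c" "e \<in> cycle_edges c" for c e
    using x that unfolding lifted_multicuts_def by blast
  have path: "x $ {a, b} \<le> (\<Sum>e\<in>path_edges p. x $ e)" if "{a, b} \<in> F" "is_path_between V E a b p" for a b p
    using x that unfolding lifted_multicuts_def by blast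
  have cut: "1 - x $ {a, b} \<le> (\<Sum>e\<in>C. 1 - x $ e)" if "{a, b} \<in> F" "is_cut_between V E a b C" for a b C
    using x that unfolding lifted_multicuts_def by blast
  note pair = simple_graph_pairD[OF D]
  define E0 where "E0 = {e \<in> E. x $ e = 0}"
  define U where "U = {v. reach E0 V u v}"
  have UV: "U \<subseteq> V" by (auto simp: U_def dest: reach_mem)
  have uU: "u \<in> U" using pair[OF uw(1)] by (auto simp: U_def intro: reach_refl)
  have inside: "x $ {a, b} = 0" if ab: "{a, b} \<in> E \<union> F" "a \<in> U" "b \<in> U" for a b
  proof -
    have "reach E0 V a b" using ab by (auto simp: U_def intro: reach_trans reach_sym)
    then obtain p where p: "is_path_between V E0 a b p" using path_of_reach by metis
    then have pE: "is_path_between V E a b p" and p0: "\<And>e. e \<in> path_edges p \<Longrightarrow> x $ e = 0"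
      by (auto simp: is_path_between_def is_path_def E0_def)
    have "x $ {a, b} \<le> 0"
    proof (cases "{a, b} \<in> E")
      case False
      then show ?thesis using path[OF _ pE] ab(1) p0 by simp
    next
      case True
      show ?thesis
      proof (cases "{a, b} \<in> path_edges p")
        case False
        have p': "p \<noteq> []" "hd p = a" "last p = b" using p by (auto simp: is_path_between_def is_path_def)
        \<comment> \<open>As \<open>{a, b}\<close> is an edge not on \<open>p\<close>, the path has
          at least three nodes and \<open>{a, b}\<close> closes it to a cycle.\<close>
        have "length p \<noteq> 1"
          using p' pair(1)[OF ab(1)] by (auto simp: length_Suc_conv)
        moreover have "length p \<noteq> 2"
          using p' False by (auto simp: length_Suc_conv numeral_2_eq_2)
        moreover have "length p \<noteq> 0" using p'(1) by simp
        ultimately have "length p \<ge> 3" by linarith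
        then have "is_cycle V E p"
          using pE True unfolding is_cycle_def cycle_edges_def is_path_between_def is_path_def
          by (auto simp: insert_commute)
        moreover have e: "{a, b} \<in> cycle_edges p" using p' by (auto simp: cycle_edges_def)
        ultimately have "x $ {a, b} \<le> (\<Sum>e'\<in>cycle_edges p - {{a, b}}. x $ e')" by (rule cyc)
        also have "\<dots> = 0"
          using p0 p' by (intro sum.neutral) (auto simp: cycle_edges_def insert_commute)
        finally show ?thesis .
      qed (use p0 in simp)
    qed
    with x01[OF ab(1)] show ?thesis by auto
  qed
  have boundaryE: "x $ {a, b} = 1" if "{a, b} \<in> E" "a \<in> U" "b \<notin> U" for a b
  proof (rule ccontr)
    assume "x $ {a, b} \<noteq> 1"
    then have "{a, b} \<in> E0" using x01 that(1) by (auto simp: E0_def)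
    then have "b \<in> U" using that pair[of a b] by (auto simp: U_def intro: reach_step)
    with that show False by simp
  qed
  have boundary: "x $ {a, b} = 1" if ab: "{a, b} \<in> E \<union> F" "a \<in> U" "b \<notin> U" for a b
  proof (cases "{a, b} \<in> E")
    case False
    have "x $ e = 1" if e: "e \<in> cut_edges E U" for e
    proof -
      have eE: "card (e \<inter> U) = 1" "e \<in> E" using e by (auto simp: cut_edges_def)
      obtain s t where st: "e = {s, t}" "s \<noteq> t"
        using simple_graph_edgeE[OF D UnI1[OF eE(2)]] by metis
      with eE have "s \<in> U \<and> t \<notin> U \<or> t \<in> U \<and> s \<notin> U"
        by (cases "s \<in> U"; cases "t \<in> U") auto
      then show ?thesis
        using boundaryE[of s t] boundaryE[of t s] st(1) eE(2) by (auto simp: insert_commute)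
    qed
    then have "(\<Sum>e\<in>cut_edges E U. 1 - x $ e) = 0" by simp
    moreover have "is_cut_between V E a b (cut_edges E U)"
      using ab UV by (auto simp: is_cut_between_def)
    ultimately have "1 - x $ {a, b} \<le> 0" using cut False ab(1) by (metis UnE)
    then show ?thesis using x01[OF ab(1)] by auto
  qed (use ab boundaryE in blast)
  \<comment> \<open>Otherwise \<open>{u, w}\<close> would be a boundary pair and have value
    1.\<close>
  have "w \<in> U" using boundary[OF uw(1) uU] uw(2) by auto
  then have "reach E0 U u w" unfolding U_def by (auto intro: reach_in_component)
  then have "reach E U u w" by (rule reach_mono_edges) (auto simp: E0_def)
  then show ?thesis using that UV inside boundary by blast
qed

lemma alternating_sum_telescope:
  fixes y :: "nat \<Rightarrow> 'a::comm_ring_1"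
  shows "(\<Sum>i<n. (- 1) ^ i * (y i + y (Suc i))) = y 0 - (- 1) ^ n * y n"
  by (induction n) (auto simp: algebra_simps)

text \<open>
  With \<open>y\<close> the indicator of the complement of the component \<open>U\<close> of \<open>u\<close> and \<open>w\<close>, every
  separating edge \<open>ab\<close> satisfies \<open>x\<^bsub>ab\<^esub> = y\<^sub>a + y\<^sub>b\<close>.
\<close>

lemma alternating_orthogonal_vector:
  fixes V :: "'v::finite set" and s :: "nat \<Rightarrow> 'v"
  assumes D: "simple_graph V (E \<union> F)" and uw: "{u, w} \<in> E \<union> F"
    and inj: "inj_on (\<lambda>i. {s i, s (Suc i)}) {..<n}"
    and edges: "\<And>i. i < n \<Longrightarrow> {s i, s (Suc i)} \<in> E \<union> F"
    and seps: "\<And>i. i < n \<Longrightarrow> is_separator V E u w {s i, s (Suc i)}"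
    and ends: "\<And>U. U \<subseteq> V \<Longrightarrow> reach E U u w \<Longrightarrow>
      of_bool (s 0 \<notin> U) = (- 1) ^ n * (of_bool (s n \<notin> U) :: real)"
  shows "\<exists>c. (\<forall>x\<in>lifted_multicuts V E F. x $ {u, w} = 0 \<longrightarrow> c \<bullet> x = 0) \<and>
    (\<forall>i<n. c $ {s i, s (Suc i)} \<noteq> 0)"
proof -
  let ?e = "\<lambda>i. {s i, s (Suc i)}"
  \<comment> \<open>The sequence \<open>s\<close> may close up, so this vector serves paths and
    cycles alike.\<close>
  define c :: "real ^ ('v set)" where "c = (\<Sum>i<n. (- 1) ^ i *\<^sub>R axis (?e i) 1)"
  have "c \<bullet> x = 0" if x: "x \<in> lifted_multicuts V E F" "x $ {u, w} = 0" for x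
  proof -
    obtain U where U: "U \<subseteq> V" "reach E U u w"
      "\<And>a b. {a, b} \<in> E \<union> F \<Longrightarrow> a \<in> U \<Longrightarrow> b \<in> U \<Longrightarrow> x $ {a, b} = 0"
      "\<And>a b. {a, b} \<in> E \<union> F \<Longrightarrow> a \<in> U \<Longrightarrow> b \<notin> U \<Longrightarrow> x $ {a, b} = 1"
      using zero_edge_component[OF D x(1) uw x(2)] by blast
    have xe: "x $ ?e i = of_bool (s i \<notin> U) + of_bool (s (Suc i) \<notin> U)" if i: "i < n" for i
    proof -
      \<comment> \<open>\<open>U\<close> connects \<open>u\<close> and \<open>w\<close>, hence meets
        every separator. This excludes the one case in which the formula could fail, both ends
        outside \<open>U\<close>.\<close>
      have "s i \<in> U \<or> s (Suc i) \<in> U"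
      proof (rule ccontr)
        assume "\<not> ?thesis"
        then have "reach E (V - ?e i) u w" using U(1) by (intro reach_mono[OF U(2)]) auto
        with seps[OF i] show False by (simp add: is_separator_iff)
      qed
      then show ?thesis
        using U(3,4)[of "s i" "s (Suc i)"] U(4)[of "s (Suc i)" "s i"] edges[OF i]
        by (cases "s i \<in> U"; cases "s (Suc i) \<in> U") (simp_all add: insert_commute)
    qed
    have "c \<bullet> x = (\<Sum>i<n. (- 1) ^ i * x $ ?e i)"
      by (simp add: c_def inner_sum_left inner_axis')
    also have "\<dots> = (\<Sum>i<n. (- 1) ^ i * (of_bool (s i \<notin> U) + of_bool (s (Suc i) \<notin> U)))"
      using xe by (intro sum.cong) auto
    also have "\<dots> = of_bool (s 0 \<notin> U) - (- 1) ^ n * of_bool (s n \<notin> U)"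
      by (rule alternating_sum_telescope)
    finally show ?thesis using ends[OF U(1,2)] by simp
  qed
  moreover have "c $ ?e j \<noteq> 0" if j: "j < n" for j
  proof -
    have "c $ ?e j = (\<Sum>i<n. (- 1) ^ i * (if ?e j = ?e i then 1 else 0))"
      unfolding c_def by (simp add: axis_def)
    \<comment> \<open>The edges are pairwise distinct, so no other summand touches this
      coordinate.\<close>
    also have "\<dots> = (\<Sum>i<n. if i = j then (- 1) ^ i else 0)"
    proof (intro sum.cong refl)
      fix i assume "i \<in> {..<n}"
      then have "?e j = ?e i \<longleftrightarrow> i = j" using inj_on_eq_iff[OF inj, of j i] j by auto
      then show "(- 1) ^ i * (if ?e j = ?e i then 1 else 0) = (if i = j then (- 1) ^ i else (0::real))"
        by simp
    qed
    finally show ?thesis using j by simp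
  qed
  ultimately show ?thesis by blast
qed

text \<open>Both paths meet \<open>{a, b}\<close>, and a node on both would be a cut-node, so each
  path contains exactly one of the two nodes.\<close>

lemma separating_edge_alternates:
  assumes p: "is_path_between V E u w p" and q: "is_path_between V E u w q"
    and pq: "\<forall>z\<in>set p \<inter> set q. is_cut_node V E u w z"
    and ab: "is_separator V E u w {a, b}" "\<not> is_cut_node V E u w a" "\<not> is_cut_node V E u w b"
  shows "a \<in> set p \<longleftrightarrow> b \<notin> set p"
proof -
  have "set p \<inter> {a, b} \<noteq> {}" "set q \<inter> {a, b} \<noteq> {}"
    using p q ab(1) unfolding is_separator_def by blast+
  with pq ab(2,3) show ?thesis by blast
qed

lemma inj_on_cycle_edges:
  assumes "is_cycle V E c"
  shows "inj_on (\<lambda>i. {c ! (i mod length c), c ! (Suc i mod length c)}) {..<length c}"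
proof (rule inj_onI)
  fix i j
  assume ij: "i \<in> {..<length c}" "j \<in> {..<length c}"
    and eq: "{c ! (i mod length c), c ! (Suc i mod length c)} =
      {c ! (j mod length c), c ! (Suc j mod length c)}"
  have c: "length c \<ge> 3" "distinct c" "c \<noteq> []" using assms by (auto simp: is_cycle_def)
  then have "Suc k mod length c < length c" for k by (intro mod_less_divisor) auto
  with ij eq c show "i = j"
    by (auto simp: doubleton_eq_iff nth_eq_iff_index_eq mod_Suc split: if_splits)
qed

text \<open>Membership in \<open>p\<close> is a proper 2-colouring of the cycle.\<close>

lemma even_cycle_without_cut_nodes:
  assumes uw: "reach E V u w" and c: "c \<noteq> []"
    and seps: "\<And>e. e \<in> cycle_edges c \<Longrightarrow> is_separator V E u w e"
    and no_cut: "\<And>v. v \<in> set c \<Longrightarrow> \<not> is_cut_node V E u w v"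
  shows "even (length c)"
proof -
  obtain p q where p: "is_path_between V E u w p" and q: "is_path_between V E u w q"
    and pq: "\<forall>z\<in>set p \<inter> set q. is_cut_node V E u w z"
    using two_paths_meeting_in_cut_nodes[OF uw] by blast
  let ?s = "\<lambda>i. c ! (i mod length c)"
  have alt: "?s i \<in> set p \<longleftrightarrow> ?s (Suc i) \<notin> set p" if "i < length c" for i
  proof (rule separating_edge_alternates[OF p q pq])
    show "is_separator V E u w {?s i, ?s (Suc i)}"
      using that c by (intro seps) (auto simp: cycle_edges_conv_image)
    show "\<not> is_cut_node V E u w (?s i)" "\<not> is_cut_node V E u w (?s (Suc i))"
      using that c by (auto intro!: no_cut)
  qed
  have "?s i \<in> set p \<longleftrightarrow> (even i \<longleftrightarrow> ?s 0 \<in> set p)" if "i \<le> length c" for i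
    using that
  proof (induction i)
    case (Suc i)
    then show ?case using alt[of i] by auto
  qed simp
  from this[of "length c"] show ?thesis by auto
qed

section \<open>Necessity of the two conditions\<close>

lemma facet_no_separating_path:
  fixes V :: "'v::finite set"
  assumes D: "simple_graph V (E \<union> F)" and uw: "{u, w} \<in> E \<union> F"
    and zero: "\<And>c f. (\<forall>x\<in>lifted_multicuts V E F. x $ {u, w} = 0 \<longrightarrow> c \<bullet> x = 0) \<Longrightarrow>
      f \<in> E \<union> F - {{u, w}} \<Longrightarrow> c $ f = 0"
    and p: "is_path V (E \<union> F) p" "length p \<ge> 2"
    and cut: "is_cut_node V E u w (hd p)" "is_cut_node V E u w (last p)"
    and seps: "\<And>e. e \<in> path_edges p \<Longrightarrow> is_separator V E u w e"
  shows "(set p, path_edges p) = ({u, w}, {{u, w}})"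
proof -
  have p': "p \<noteq> []" "distinct p" "path_edges p \<subseteq> E \<union> F" using p(1) by (auto simp: is_path_def)
  let ?n = "length p - 1"
  \<comment> \<open>A cut-node lies in every \<open>U\<close> that connects \<open>u\<close> and
    \<open>w\<close>, so both end terms of the telescoped sum vanish.\<close>
  have inside: "of_bool (v \<notin> U) = (0::real)"
    if "is_cut_node V E u w v" "U \<subseteq> V" "reach E U u w" for U v
    using that reach_mono[of E U u w "V - {v}"] by (auto simp: is_cut_node_iff)
  have in_path: "{p ! i, p ! Suc i} \<in> path_edges p" if "i < ?n" for i
    using that by (intro path_edges_nth) auto
  have ends: "of_bool (p ! 0 \<notin> U) = (- 1) ^ ?n * (of_bool (p ! ?n \<notin> U) :: real)"
    if "U \<subseteq> V" "reach E U u w" for U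
    using inside[OF cut(1) that] inside[OF cut(2) that] p'(1)
    by (simp add: hd_conv_nth last_conv_nth)
  obtain c where c: "\<forall>x\<in>lifted_multicuts V E F. x $ {u, w} = 0 \<longrightarrow> c \<bullet> x = 0"
      "\<forall>i<?n. c $ {p ! i, p ! Suc i} \<noteq> 0"
    using alternating_orthogonal_vector[OF D uw inj_on_path_edges[OF p'(2)] _ _ ends]
      in_path p'(3) seps by blast
  have only: "{p ! i, p ! Suc i} = {u, w}" if "i < ?n" for i
    using zero[OF c(1)] c(2) in_path[OF that] p'(3) that by blast
  \<comment> \<open>Every edge of the path must be \<open>{u, w}\<close>, and the edges are
    distinct, so there is just one.\<close>
  have "?n = 1"
  proof (rule ccontr)
    assume "?n \<noteq> 1"
    then have "0 < ?n" "1 < ?n" using p(2) by auto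
    then have "(0::nat) = 1" using only by (intro inj_onD[OF inj_on_path_edges[OF p'(2)]]) auto
    then show False by simp
  qed
  then have "length p = 2" by simp
  then obtain a b where ab: "p = [a, b]" by (auto simp: length_Suc_conv numeral_2_eq_2)
  then show ?thesis using only[of 0] by auto
qed

text \<open>The end terms cancel for even length and vanish if the cycle starts at a cut-node. A
  rotation brings a cut-node to the front; without cut-nodes the length is even. The resulting
  vector is nonzero on every edge, yet at most one edge is \<open>{u, w}\<close>.\<close>

lemma facet_no_separating_cycle:
  fixes V :: "'v::finite set"
  assumes G: "connected_graph V E" and D: "simple_graph V (E \<union> F)" and uw: "{u, w} \<in> E \<union> F"
    and zero: "\<And>c f. (\<forall>x\<in>lifted_multicuts V E F. x $ {u, w} = 0 \<longrightarrow> c \<bullet> x = 0) \<Longrightarrow>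
      f \<in> E \<union> F - {{u, w}} \<Longrightarrow> c $ f = 0"
    and cyc: "is_cycle V (E \<union> F) c"
    and seps: "\<And>e. e \<in> cycle_edges c \<Longrightarrow> is_separator V E u w e"
  shows False
proof -
  have False
    if cyc: "is_cycle V (E \<union> F) c" and seps: "\<And>e. e \<in> cycle_edges c \<Longrightarrow> is_separator V E u w e"
      and start: "even (length c) \<or> is_cut_node V E u w (c ! 0)" for c
  proof -
    let ?n = "length c" and ?s = "\<lambda>i. c ! (i mod length c)"
    have c: "?n \<ge> 3" "c \<noteq> []" "cycle_edges c \<subseteq> E \<union> F" using cyc by (auto simp: is_cycle_def)
    have in_cycle: "{?s i, ?s (Suc i)} \<in> cycle_edges c" if "i < ?n" for i
      using that c(2) by (auto simp: cycle_edges_conv_image)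
    have ends: "of_bool (?s 0 \<notin> U) = (- 1) ^ ?n * (of_bool (?s ?n \<notin> U) :: real)"
      if "U \<subseteq> V" "reach E U u w" for U
      using start that reach_mono[of E U u w "V - {c ! 0}"] by (auto simp: is_cut_node_iff)
    obtain d where d: "\<forall>x\<in>lifted_multicuts V E F. x $ {u, w} = 0 \<longrightarrow> d \<bullet> x = 0"
        "\<forall>i<?n. d $ {?s i, ?s (Suc i)} \<noteq> 0"
      using alternating_orthogonal_vector[OF D uw inj_on_cycle_edges[OF cyc] _ _ ends]
        in_cycle c(3) seps by blast
    have only: "{?s i, ?s (Suc i)} = {u, w}" if "i < ?n" for i
      using zero[OF d(1)] d(2) in_cycle[OF that] c(3) that by blast
    have eq: "{?s 0, ?s (Suc 0)} = {?s 1, ?s (Suc 1)}"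
      by (rule trans[OF only only[symmetric]]) (use c(1) in auto)
    have "(0::nat) = 1"
      by (rule inj_onD[OF inj_on_cycle_edges[OF cyc] eq]) (use c(1) in auto)
    then show False by simp
  qed
  note * = this
  show False
  proof (cases "\<exists>v\<in>set c. is_cut_node V E u w v")
    case True
    then obtain i where i: "i < length c" "is_cut_node V E u w (c ! i)" by (auto simp: in_set_conv_nth)
    then have "rotate i c ! 0 = c ! i" using nth_rotate[of 0 c i] by fastforce
    then show False
      using *[of "rotate i c"] cyc seps i by (simp add: is_cycle_rotate cycle_edges_rotate)
  next
    case False
    have "u \<in> V" "w \<in> V" using simple_graph_pairD[OF D uw] by auto
    then have "reach E V u w" using G by (simp add: connected_graph_def reach_iff_path)
    then have "even (length c)"
      using False seps cyc by (intro even_cycle_without_cut_nodes) (auto simp: is_cycle_def)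
    then show False using *[OF cyc seps] by blast
  qed
qed

theorem theorem1:
  fixes V :: "'v::finite set" and E F :: "'v set set" and u w :: 'v
  assumes "connected_graph V E"
    and "simple_graph V (E \<union> F)"
    and "F \<inter> E = {}"
    and "{u, w} \<in> E \<union> F"
  shows "facet_defining (- axis {u, w} 1) 0 (lifted_multicut_polytope V E F) \<longleftrightarrow>
    (\<nexists>p. is_path V (E \<union> F) p \<and> length p \<ge> 2 \<and>
        (set p, path_edges p) \<noteq> ({u, w}, {{u, w}}) \<and>
        is_cut_node V E u w (hd p) \<and> is_cut_node V E u w (last p) \<and>
        (\<forall>e\<in>path_edges p. is_separator V E u w e)) \<and>
    (\<nexists>c. is_cycle V (E \<union> F) c \<and> (\<forall>e\<in>cycle_edges c. is_separator V E u w e))"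
    (is "_ \<longleftrightarrow> ?no_path \<and> ?no_cycle")
proof -
  note G = assms(1) and D = assms(2) and uw = assms(4)
  let ?X = "lifted_multicuts V E F"
  let ?zero = "\<forall>c. (\<forall>x\<in>?X. x $ {u, w} = 0 \<longrightarrow> c \<bullet> x = 0) \<longrightarrow> (\<forall>f\<in>E \<union> F - {{u, w}}. c $ f = 0)"
  have uwV: "u \<in> V" "w \<in> V" using simple_graph_pairD[OF D uw] by auto
  have "?zero \<longleftrightarrow> ?no_path \<and> ?no_cycle"
  proof
    assume ?zero
    then have zero: "c $ f = 0"
      if "\<forall>x\<in>?X. x $ {u, w} = 0 \<longrightarrow> c \<bullet> x = 0" "f \<in> E \<union> F - {{u, w}}" for c f
      using that by blast
    have ?no_path using facet_no_separating_path[OF D uw zero] by blast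
    moreover have ?no_cycle using facet_no_separating_cycle[OF G D uw zero] by blast
    ultimately show "?no_path \<and> ?no_cycle" ..
  next
    assume no: "?no_path \<and> ?no_cycle"
    show ?zero
    proof (intro allI impI)
      fix c assume c: "\<forall>x\<in>?X. x $ {u, w} = 0 \<longrightarrow> c \<bullet> x = 0"
      interpret orthogonal_vector V E "E \<union> F" u w c
      proof
        fix K A assume K: "clustering V E K" "A \<in> K" "u \<in> A" "w \<in> A"
        then have "multicut (E \<union> F) K $ {u, w} = 0" by (auto simp: multicut_def)
        with c multicut_mem[OF D K(1)] show "c \<bullet> multicut (E \<union> F) K = 0" by blast
      qed (fact G D uwV)+
      \<comment> \<open>The support of \<open>c\<close> without \<open>{u, w}\<close>; a path in it
        is never the exempted one.\<close>
      define S where "S = {e \<in> E \<union> F. e \<noteq> {u, w} \<and> c $ e \<noteq> 0}"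
      have sep: "is_separator V E u w e" if "e \<in> S" for e
      proof -
        have e: "e \<in> E \<union> F" "c $ e \<noteq> 0" using that by (auto simp: S_def)
        then obtain a b where "e = {a, b}" using simple_graph_edgeE[OF D] by metis
        with e show ?thesis using nonseparator_zero by blast
      qed
      have cut_uw: "is_cut_node V E u w u" "is_cut_node V E u w w"
        using uwV by (auto simp: is_cut_node_iff dest: reach_mem)
      \<comment> \<open>If \<open>e\<close> were the only edge of \<open>S\<close> at
        \<open>b\<close>, it would be the only nonzero term of a sum equal to zero; the pair
        \<open>{u, w}\<close> is not incident to \<open>b\<close>, as \<open>u\<close> and
        \<open>w\<close> are cut-nodes.\<close>
      have deg: "\<exists>e'\<in>S. e' \<noteq> e \<and> b \<in> e'"
        if b: "b \<in> V" "\<not> is_cut_node V E u w b" and e: "e \<in> S" "b \<in> e" for b e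
      proof (rule ccontr)
        assume other: "\<not> ?thesis"
        have "b \<notin> {u, w}" using b cut_uw by auto
        then have "(\<Sum>e' | e' \<in> E \<union> F \<and> b \<in> e'. c $ e') = (\<Sum>e'\<in>{e}. c $ e')"
          using other e by (intro sum.mono_neutral_right) (auto simp: S_def)
        then show False using sum_incident_zero[OF b] e(1) by (simp add: S_def)
      qed
      have S: "simple_graph V S" "S \<subseteq> E \<union> F" using D by (auto simp: S_def simple_graph_def)
      have "S = {}"
      proof (rule ccontr)
        assume ne: "S \<noteq> {}"
        have no_cycle: "\<nexists>d. is_cycle V S d"
        proof
          assume "\<exists>d. is_cycle V S d"
          then obtain d where "is_cycle V S d" ..
          then have "is_cycle V (E \<union> F) d" "\<forall>e\<in>cycle_edges d. is_separator V E u w e"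
            using S(2) sep by (auto simp: is_cycle_def)
          with no show False by blast
        qed
        obtain p where p: "is_path V S p" "length p \<ge> 2"
          "is_cut_node V E u w (hd p)" "is_cut_node V E u w (last p)"
          using cycle_or_terminal_path[OF S(1) ne deg no_cycle] by blast
        have "path_edges p \<subseteq> S" using p(1) by (simp add: is_path_def)
        moreover have "{u, w} \<notin> S" by (simp add: S_def)
        ultimately have "path_edges p \<noteq> {{u, w}}" by auto
        moreover have "is_path V (E \<union> F) p" using p(1) S(2) by (auto simp: is_path_def)
        moreover have "\<forall>e\<in>path_edges p. is_separator V E u w e"
          using sep \<open>path_edges p \<subseteq> S\<close> by blast
        ultimately show False using no p by auto
      qed
      then show "\<forall>f\<in>E \<union> F - {{u, w}}. c $ f = 0" by (auto simp: S_def)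
    qed
  qed
  then show ?thesis using facet_defining_iff_orthogonal[OF G D uw] by simp
qed

end
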